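(* Let $\mathbb{F}$ be a field, $R=\mathbb{F}[t]$, $K=\mathbb{F}(t)$. If $V$ is a nonzero torsion-free $R$-module, then the center $Z$ of ${\rm L}(V^* )_R$ is isomorphic to the algebra $A:=\bigcap_{p\in P_V}(K\cap\hat{R}_p)$, where $P_V$ is the set of all primes $p\in R$ such that $pV\neq V$. In other words, if $V$ is a nonzero vector space over $\mathbb{F}$ and an operator $a\in{\rm L}(V)$ is such that $p(a)$ is injective for all nonzero $p\in R$, then the bicommutant $(a^* )^{\prime\prime}$ of $a^*$ in ${\rm L}(V^* )$ is isomorphic to the subalgebra $A$ of $K$ consisting of all $r=u/v$ ($u,v\in R$ relatively prime) such that $v(a)$ is invertible.
   Context: A prime in $R=\mathbb{F}[t]$ is a monic irreducible polynomial. ${\rm L}(V)$ is the algebra of all linear operators on $V$; a vector space $V$ with $a\in{\rm L}(V)$ is an $R$-module via $t\mapsto a$. $V^*$ is the vector space dual of $V$, an $R$-module via $t\mapsto a^*$, where $a^*(\rho)=\rho\circ a$; ${\rm L}(V^* )_R$ is the algebra of $R$-module endomorphisms of $V^*$. The bicommutant of a set is the commutant of its commutant. For a prime $p$, $\hat{R}_p=\varprojlim_n R/(p^n)$, and $R_p=\{u/v: u,v\in R,\ v\text{ prime to }p\}\subseteq K$ is regarded as a subring of $\hat R_p$ via the canonical monomorphism sending $u/v$ to the element whose component in $R/(p^n)$ is the class of $u$ times the inverse of the class of $v$. Under this identification $K\cap\hat{R}_p=R_p$. An intersection over the empty set of primes is understood to be $K$. *)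

theory Defs
  imports
    "HOL-Algebra.QuotRing"
    "HOL-Algebra.Module"
    "HOL-Library.Function_Algebras"
    "HOL-Computational_Algebra.Fraction_Field"
    "HOL-Computational_Algebra.Polynomial_Factorial"
begin

section \<open>Algebras, commutants, isomorphism\<close>

text \<open>
  An algebra over the field \<open>'f\<close> is represented by a record of type \<open>('f, _) module\<close>,
  whose scalars are the elements of the type \<open>'f\<close>.
\<close>

definition alg_iso :: "('f, 'x) module \<Rightarrow> ('f, 'y) module \<Rightarrow> ('x \<Rightarrow> 'y) set" where
  "alg_iso M N = {h \<in> ring_iso M N. \<forall>c. \<forall>x\<in>carrier M. h (c \<odot>\<^bsub>M\<^esub> x) = c \<odot>\<^bsub>N\<^esub> h x}"

definition alg_isomorphic :: "('f, 'x) module \<Rightarrow> ('f, 'y) module \<Rightarrow> bool" where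
  "alg_isomorphic M N \<longleftrightarrow> alg_iso M N \<noteq> {}"

definition commutant :: "('f, 'x) module \<Rightarrow> 'x set \<Rightarrow> 'x set" where
  "commutant M X = {z \<in> carrier M. \<forall>x\<in>X. z \<otimes>\<^bsub>M\<^esub> x = x \<otimes>\<^bsub>M\<^esub> z}"

definition center_alg :: "('f, 'x) module \<Rightarrow> ('f, 'x) module" where
  "center_alg M = M\<lparr>carrier := commutant M (carrier M)\<rparr>"

definition bicommutant_alg :: "('f, 'x) module \<Rightarrow> 'x set \<Rightarrow> ('f, 'x) module" where
  "bicommutant_alg M X = M\<lparr>carrier := commutant M (commutant M X)\<rparr>"


section \<open>Operators and the dual space\<close>

text \<open>The operator \<open>p(a)\<close>; equivalently the \<open>F[t]\<close>-module structure with \<open>t\<close> acting as \<open>a\<close>.\<close>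

definition poly_op ::
  "('f::field \<Rightarrow> 'w \<Rightarrow> 'w) \<Rightarrow> ('w \<Rightarrow> 'w) \<Rightarrow> 'f poly \<Rightarrow> 'w \<Rightarrow> 'w::ab_group_add" where
  "poly_op scale a p w = (\<Sum>i\<le>degree p. scale (coeff p i) ((a ^^ i) w))"

text \<open>
  Maps on a subgroup \<open>W\<close> of the type \<open>'w\<close> that are linear over the scalars \<open>'r\<close>. They are
  extensional, so that two maps are equal iff they agree on \<open>W\<close>.
\<close>

definition endos :: "'w::ab_group_add set \<Rightarrow> ('r \<Rightarrow> 'w \<Rightarrow> 'w) \<Rightarrow> ('w \<Rightarrow> 'w) set" where
  "endos W scale = {T \<in> W \<rightarrow>\<^sub>E W.
     (\<forall>x\<in>W. \<forall>y\<in>W. T (x + y) = T x + T y) \<and> (\<forall>c. \<forall>x\<in>W. T (scale c x) = scale c (T x))}"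

definition op_alg ::
  "'w::ab_group_add set \<Rightarrow> ('f \<Rightarrow> 'w \<Rightarrow> 'w) \<Rightarrow> ('w \<Rightarrow> 'w) set \<Rightarrow> ('f, 'w \<Rightarrow> 'w) module" where
  "op_alg W scale S =
    \<lparr>carrier = S,
     monoid.mult = compose W,
     one = (\<lambda>x\<in>W. x),
     zero = (\<lambda>x\<in>W. 0),
     add = (\<lambda>T U. \<lambda>x\<in>W. T x + U x),
     module.smult = (\<lambda>c T. \<lambda>x\<in>W. scale c (T x))\<rparr>"

text \<open>
  The dual \<open>V*\<close> sits inside the type of all functions \<open>'v \<Rightarrow> 'f\<close>, whose addition is pointwise.
\<close>

definition dual :: "('f::field \<Rightarrow> 'v::ab_group_add \<Rightarrow> 'v) \<Rightarrow> ('v \<Rightarrow> 'f) set" where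
  "dual scale = {\<rho>. Vector_Spaces.linear scale (*) \<rho>}"

definition dual_scale :: "'f::field \<Rightarrow> ('v \<Rightarrow> 'f) \<Rightarrow> ('v \<Rightarrow> 'f)" where
  "dual_scale c \<rho> = (\<lambda>v. c * \<rho> v)"

definition transp :: "('v \<Rightarrow> 'v) \<Rightarrow> ('v \<Rightarrow> 'f) \<Rightarrow> ('v \<Rightarrow> 'f)" where
  "transp a \<rho> = \<rho> \<circ> a"

definition L_dual ::
  "('f::field \<Rightarrow> 'v::ab_group_add \<Rightarrow> 'v) \<Rightarrow> ('f, ('v \<Rightarrow> 'f) \<Rightarrow> ('v \<Rightarrow> 'f)) module" where
  "L_dual scale = op_alg (dual scale) dual_scale (endos (dual scale) dual_scale)"

text \<open>\<open>a*\<close> as an element of \<open>L(V*)\<close>\<close>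

definition adj ::
  "('f::field \<Rightarrow> 'v::ab_group_add \<Rightarrow> 'v) \<Rightarrow> ('v \<Rightarrow> 'v) \<Rightarrow> ('v \<Rightarrow> 'f) \<Rightarrow> ('v \<Rightarrow> 'f)" where
  "adj scale a = restrict (transp a) (dual scale)"

text \<open>
  For an \<open>F[t]\<close>-module \<open>V\<close> with action \<open>act\<close>: the underlying vector space of \<open>V\<close>, the action of
  \<open>F[t]\<close> on \<open>V*\<close> (where \<open>t\<close> acts as the dual of the operator \<open>act t\<close>), and the algebra
  \<open>L(V*)\<^sub>R\<close> of module endomorphisms of \<open>V*\<close>.
\<close>

definition base_scale :: "('f::field poly \<Rightarrow> 'v \<Rightarrow> 'v) \<Rightarrow> 'f \<Rightarrow> 'v \<Rightarrow> 'v" where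
  "base_scale act c = act [:c:]"

definition dual_act ::
  "('f::field poly \<Rightarrow> 'v \<Rightarrow> 'v) \<Rightarrow> 'f poly \<Rightarrow> ('v \<Rightarrow> 'f) \<Rightarrow> ('v \<Rightarrow> 'f)" where
  "dual_act act = poly_op dual_scale (transp (act [:0, 1:]))"

definition L_dual_R ::
  "('f::field poly \<Rightarrow> 'v::ab_group_add \<Rightarrow> 'v) \<Rightarrow> ('f, ('v \<Rightarrow> 'f) \<Rightarrow> ('v \<Rightarrow> 'f)) module" where
  "L_dual_R act =
    op_alg (dual (base_scale act)) dual_scale (endos (dual (base_scale act)) (dual_act act))"

definition torsion_free :: "('r::zero \<Rightarrow> 'v::zero \<Rightarrow> 'v) \<Rightarrow> bool" where
  "torsion_free act \<longleftrightarrow> (\<forall>r v. act r v = 0 \<longrightarrow> r = 0 \<or> v = 0)"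

definition invertible_op :: "('f::field \<Rightarrow> 'v::ab_group_add \<Rightarrow> 'v) \<Rightarrow> ('v \<Rightarrow> 'v) \<Rightarrow> bool" where
  "invertible_op scale T \<longleftrightarrow>
    (\<exists>S. Vector_Spaces.linear scale scale S \<and> S \<circ> T = id \<and> T \<circ> S = id)"


section \<open>Subalgebras of the field of rational functions\<close>

definition rat_alg :: "'f::field poly fract set \<Rightarrow> ('f, 'f poly fract) module" where
  "rat_alg S =
    \<lparr>carrier = S, monoid.mult = (*), one = 1, zero = 0, add = (+), module.smult = (\<lambda>c r. Fract [:c:] 1 * r)\<rparr>"

definition prime_poly :: "'f::field poly \<Rightarrow> bool" where
  "prime_poly p \<longleftrightarrow> irreducible p \<and> lead_coeff p = 1"

text \<open>
  The inverse limit of the rings \<open>R/(p^n)\<close>: a class modulo \<open>p^n\<close> is represented by its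
  canonical representative, the remainder modulo \<open>p^n\<close>. The case \<open>m = n\<close> of the condition says
  that the components are such remainders.
\<close>

definition Rhat :: "'f::field poly \<Rightarrow> (nat \<Rightarrow> 'f poly) ring" where
  "Rhat p =
    \<lparr>carrier = {x. \<forall>m n. m \<le> n \<longrightarrow> x n mod p ^ m = x m},
     monoid.mult = (\<lambda>x y n. (x n * y n) mod p ^ n),
     one = (\<lambda>n. 1 mod p ^ n),
     zero = (\<lambda>n. 0),
     add = (\<lambda>x y n. (x n + y n) mod p ^ n)\<rparr>"

definition to_Rhat :: "'f::field poly \<Rightarrow> 'f poly \<Rightarrow> (nat \<Rightarrow> 'f poly)" where
  "to_Rhat p u = (\<lambda>n. u mod p ^ n)"

text \<open>
  \<open>K \<inter> Rhat p\<close>, formed in the field of fractions of \<open>Rhat p\<close>: the fraction \<open>u/v\<close> equals the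
  element \<open>x\<close> of \<open>Rhat p\<close> iff \<open>x v = u\<close> in \<open>Rhat p\<close>. By the lemma \<open>K_Int_Rhat_eq\<close> below this
  is the localization \<open>R\<^sub>p\<close>, on which \<open>u/v \<mapsto> x\<close> is the canonical monomorphism \<open>R\<^sub>p \<rightarrow> Rhat p\<close>.
\<close>

definition K_Int_Rhat :: "'f::field poly \<Rightarrow> 'f poly fract set" where
  "K_Int_Rhat p = {Fract u v | u v. v \<noteq> 0 \<and>
     (\<exists>x\<in>carrier (Rhat p). x \<otimes>\<^bsub>Rhat p\<^esub> to_Rhat p v = to_Rhat p u)}"

definition R_loc :: "'f::field poly \<Rightarrow> 'f poly fract set" where
  "R_loc p = {Fract u v | u v. v \<noteq> 0 \<and> coprime v p}"

definition P_set :: "('f::field poly \<Rightarrow> 'v \<Rightarrow> 'v) \<Rightarrow> 'f poly set" where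
  "P_set act = {p. prime_poly p \<and> range (act p) \<noteq> UNIV}"

definition A_set :: "('f::field poly \<Rightarrow> 'v \<Rightarrow> 'v) \<Rightarrow> 'f poly fract set" where
  "A_set act = (\<Inter>p\<in>P_set act. K_Int_Rhat p)"

definition A_inv_set ::
  "('f::field \<Rightarrow> 'v::ab_group_add \<Rightarrow> 'v) \<Rightarrow> ('v \<Rightarrow> 'v) \<Rightarrow> 'f poly fract set" where
  "A_inv_set scale a =
    {Fract u v | u v. v \<noteq> 0 \<and> coprime u v \<and> invertible_op scale (poly_op scale a v)}"

lemma irreducible_bezout:
  fixes p v :: "'f::field poly"
  assumes p: "irreducible p" and v: "\<not> p dvd v"
  shows "\<exists>s t. s * v + t * p = 1"
proof -
  define I where "I = {d. d \<noteq> 0 \<and> (\<exists>s t. d = s * v + t * p)}"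
  have "p = 0 * v + 1 * p" by simp
  then have "p \<in> I" using p unfolding I_def by (metis (mono_tags, lifting) mem_Collect_eq not_irreducible_zero)
  then obtain d where d: "d \<in> I" "\<And>e. e \<in> I \<Longrightarrow> degree d \<le> degree e"
    using ex_has_least_nat[of "\<lambda>d. d \<in> I" p degree] by blast
  obtain s t where st: "d = s * v + t * p" and d0: "d \<noteq> 0" using d by (auto simp: I_def)
  have dv: "d dvd s' * v + t' * p" for s' t'
  proof (rule ccontr)
    assume "\<not> ?thesis"
    then have n: "(s' * v + t' * p) mod d \<noteq> 0" by (simp add: dvd_eq_mod_eq_0)
    let ?q = "(s' * v + t' * p) div d"
    have "(s' * v + t' * p) mod d = (s' * v + t' * p) - ?q * d"
      by (simp add: minus_div_mult_eq_mod)
    also have "\<dots> = (s' - ?q * s) * v + (t' - ?q * t) * p"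
      by (subst (2) st) (simp add: algebra_simps)
    finally have "(s' * v + t' * p) mod d \<in> I" using n unfolding I_def by blast
    then show False using d(2) degree_mod_less'[OF d0 n] by fastforce
  qed
  have "d dvd v" "d dvd p" using dv[of 1 0] dv[of 0 1] by auto
  have "is_unit d"
  proof (rule ccontr)
    assume "\<not> is_unit d"
    then have "p dvd d" using \<open>d dvd p\<close> p by (metis irreducible_altdef)
    then show False using v \<open>d dvd v\<close> dvd_trans by blast
  qed
  then obtain e where "1 = d * e" by blast
  then have "(e * s) * v + (e * t) * p = 1" using st by (simp add: algebra_simps)
  then show ?thesis by blast
qed

lemma irreducible_bezout_power:
  fixes p v :: "'f::field poly"
  assumes p: "irreducible p" and v: "\<not> p dvd v"
  shows "\<exists>s. p ^ n dvd s * v - 1"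
proof -
  obtain s t where "s * v + t * p = 1" using irreducible_bezout[OF p v] by blast
  then have t: "t * p = 1 - s * v" by (simp add: algebra_simps)
  have "1 - (t * p) ^ n = (1 - t * p) * (\<Sum>i<n. (t * p) ^ i)" by (rule one_diff_power_eq)
  then obtain w where w: "1 - (t * p) ^ n = s * v * w" using t by auto
  then have "(w * s) * v - 1 = - (t ^ n) * p ^ n"
    by (simp add: algebra_simps power_mult_distrib)
  then have "p ^ n dvd (w * s) * v - 1" by (metis dvd_triv_right)
  then show ?thesis by blast
qed

lemma irreducible_coprime_iff:
  fixes p v :: "'f::field poly"
  assumes p: "irreducible p"
  shows "coprime v p \<longleftrightarrow> \<not> p dvd v"
proof
  assume "coprime v p"
  then show "\<not> p dvd v"
    using p coprime_common_divisor[of v p p] irreducible_not_unit[of p] by auto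
next
  assume "\<not> p dvd v"
  then obtain s t where "s * v + t * p = 1" using irreducible_bezout[OF p] by blast
  then show "coprime v p" by (intro coprimeI) (metis dvd_add dvd_mult)
qed

lemma Rhat_mult_to_Rhat_iff:
  "x \<otimes>\<^bsub>Rhat p\<^esub> to_Rhat p v = to_Rhat p u \<longleftrightarrow> (\<forall>n. p ^ n dvd x n * v - u)"
  by (simp add: Rhat_def to_Rhat_def fun_eq_iff mod_mult_right_eq mod_eq_dvd_iff)

lemma K_Int_Rhat_eq:
  fixes p :: "'f::field poly"
  assumes "prime_poly p"
  shows "K_Int_Rhat p = R_loc p"
proof
  have p: "irreducible p" using assms by (simp add: prime_poly_def)
  have "Fract u v \<in> R_loc p"
    if "v \<noteq> 0" "x \<in> carrier (Rhat p)" "\<forall>n. p ^ n dvd x n * v - u" for u v x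
    using that
  proof (induction "degree v" arbitrary: u v rule: less_induct)
    case less
    show ?case
    proof (cases "p dvd v")
      case False
      then show ?thesis using less.prems irreducible_coprime_iff[OF p] by (auto simp: R_loc_def)
    next
      case True
      then obtain v' where v': "v = p * v'" by blast
      have "p dvd x 1 * v - u" using less.prems(3) by (metis power_one_right)
      then have "p dvd u" using True by (metis dvd_diff_right_iff dvd_mult)
      then obtain u' where u': "u = p * u'" by blast
      have p0: "p \<noteq> 0" and v0: "v' \<noteq> 0" using less.prems v' by auto
      have "degree p \<noteq> 0" using p p0 by (metis irreducible_not_unit is_unit_iff_degree)
      then have deg: "degree v' < degree v" using p0 v0 by (simp add: v' degree_mult_eq)
      have "p ^ n dvd x n * v' - u'" for n
      proof -
        have "p * p ^ n dvd p * (x (Suc n) * v' - u')"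
          using less.prems(3)[rule_format, of "Suc n"] by (simp add: v' u' algebra_simps)
        then have 1: "p ^ n dvd x (Suc n) * v' - u'" using p0 by (simp only: dvd_mult_cancel_left) simp
        have x2: "x (Suc n) mod p ^ n = x n" "x n mod p ^ n = x n"
          using less.prems(2) by (simp_all add: Rhat_def)
        then have "p ^ n dvd x (Suc n) - x n" by (simp add: mod_eq_dvd_iff[symmetric])
        then have "p ^ n dvd (x (Suc n) * v' - u') - (x (Suc n) - x n) * v'"
          by (rule dvd_diff[OF 1 dvd_mult2])
        then show ?thesis by (simp add: algebra_simps)
      qed
      then have "Fract u' v' \<in> R_loc p" using less.hyps[OF deg v0 less.prems(2)] by blast
      moreover have "Fract u v = Fract u' v'" using p0 v0 by (simp add: u' v' eq_fract)
      ultimately show ?thesis by simp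
    qed
  qed
  then show "K_Int_Rhat p \<subseteq> R_loc p"
    by (auto simp: K_Int_Rhat_def Rhat_mult_to_Rhat_iff)
next
  have p: "irreducible p" using assms by (simp add: prime_poly_def)
  have "\<exists>x\<in>carrier (Rhat p). \<forall>n. p ^ n dvd x n * v - u" if v: "coprime v p" for u v
  proof -
    have "\<exists>s. p ^ n dvd s * v - 1" for n
      using irreducible_bezout_power[OF p] v irreducible_coprime_iff[OF p] by blast
    then obtain s where s: "p ^ n dvd s n * v - 1" for n by metis
    define x where "x n = (u * s n) mod p ^ n" for n
    have x: "p ^ n dvd x n * v - u" for n
    proof -
      have "x n * v mod p ^ n = (u * s n) * v mod p ^ n" by (simp add: x_def mod_mult_left_eq)
      also have "\<dots> = u mod p ^ n"
        unfolding mod_eq_dvd_iff using dvd_mult[OF s[of n], of u] by (simp add: algebra_simps)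
      finally show ?thesis by (simp add: mod_eq_dvd_iff)
    qed
    have "x n mod p ^ m = x m" if "m \<le> n" for m n
    proof -
      have "p ^ m dvd x n * v - u" using x[of n] that by (meson dvd_trans le_imp_power_dvd)
      then have "p ^ m dvd s m * ((x n * v - u) - (x m * v - u)) - (s m * v - 1) * (x n - x m)"
        by (rule dvd_diff[OF dvd_mult[OF dvd_diff[OF _ x[of m]]] dvd_mult2[OF s[of m]]])
      then have "p ^ m dvd x n - x m" by (simp add: algebra_simps)
      then have "x n mod p ^ m = x m mod p ^ m" by (simp add: mod_eq_dvd_iff)
      then show ?thesis by (simp add: x_def)
    qed
    then have "x \<in> carrier (Rhat p)" by (simp add: Rhat_def)
    then show ?thesis using x by blast
  qed
  then show "R_loc p \<subseteq> K_Int_Rhat p"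
    unfolding K_Int_Rhat_def R_loc_def Rhat_mult_to_Rhat_iff by blast
qed

end

theory Submission
  imports Defs
begin

text \<open>
  The dual \<open>V*\<close> of a torsion-free \<open>F[t]\<close>-module \<open>V\<close> is divisible (\<open>Vdual_divisible\<close>), hence
  injective because \<open>F[t]\<close> is a principal ideal domain (\<open>divisible_imp_injective\<close>). If \<open>V \<noteq> 0\<close>, then
  \<open>V*\<close> also contains an element \<open>w\<close> that no nonzero polynomial annihilates (\<open>exists_non_torsion\<close>).
  Injectivity supplies enough endomorphisms of \<open>V*\<close> to control a central one, \<open>z\<close>: an endomorphism
  that kills \<open>w\<close> and maps \<open>z w\<close> to \<open>w\<close> cannot exist, so \<open>w\<close> and \<open>z w\<close> are linearly dependent, say
  \<open>v (z w) = u w\<close> with \<open>v \<noteq> 0\<close>; and as \<open>w\<close> can be mapped to any element of \<open>V*\<close>, the relation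
  \<open>v z = u\<close> holds on all of \<open>V*\<close> (\<open>center_is_fraction\<close>). The isomorphism sends \<open>z\<close> to \<open>u/v\<close>.
  
  It remains to see which fractions occur. For a prime \<open>p\<close> the kernel of \<open>p\<close> on \<open>V*\<close> is the
  annihilator of \<open>p V\<close>. If \<open>p V \<noteq> V\<close>, this kernel is nonzero, and on it \<open>v z = u\<close> forces \<open>p\<close> to be
  prime to the reduced denominator (\<open>acts_as_in_A_set\<close>). Conversely, if the primes dividing \<open>v\<close> all
  satisfy \<open>p V = V\<close>, then \<open>v\<close> is invertible on \<open>V\<close> and on \<open>V*\<close>, and \<open>u/v\<close> is a central endomorphism
  (\<open>exists_acts_as\<close>). By the description of \<open>K \<inter> Rhat p\<close> as a localization, these fractions are the
  elements of \<open>A\<close> (\<open>A_set_iff\<close>).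
  
  For an operator \<open>a\<close>, the commutant of \<open>a*\<close> is the algebra of module endomorphisms of \<open>V*\<close>, and its
  commutant is its center (\<open>bicommutant_eq_center\<close>), so the second half is a translation of the first.
\<close>


section \<open>Divisibility in \<open>F[t]\<close>\<close>

lemma poly_ideal_principal:
  fixes I :: "'f::field poly set"
  assumes zero: "0 \<in> I" and add: "\<And>p q. p \<in> I \<Longrightarrow> q \<in> I \<Longrightarrow> p + q \<in> I"
    and mult: "\<And>r p. p \<in> I \<Longrightarrow> r * p \<in> I"
  shows "\<exists>d\<in>I. \<forall>p\<in>I. d dvd p"
proof (cases "I \<subseteq> {0}")
  case True
  then show ?thesis using zero by auto
next
  case False
  then obtain d where d: "d \<in> I" "d \<noteq> 0"
      and least: "\<And>e. e \<in> I \<Longrightarrow> e \<noteq> 0 \<Longrightarrow> degree d \<le> degree e"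
    using ex_has_least_nat[of "\<lambda>d. d \<in> I \<and> d \<noteq> 0" _ degree] by blast
  have "d dvd p" if "p \<in> I" for p
  proof (rule ccontr)
    assume "\<not> d dvd p"
    then have nz: "p mod d \<noteq> 0" by (simp add: dvd_eq_mod_eq_0)
    have "p mod d = p + (- (p div d)) * d" by (simp add: minus_div_mult_eq_mod[symmetric])
    then have "p mod d \<in> I" using add[OF that mult[OF d(1)]] by metis
    then show False using least nz degree_mod_less'[OF d(2) nz] by fastforce
  qed
  then show ?thesis using d(1) by blast
qed

text \<open>
  A generator of the ideal \<open>(u, v)\<close> serves as greatest common divisor: it divides both, and
  the identity that expresses it through \<open>u\<close> and \<open>v\<close> becomes a Bezout identity of the quotients.
\<close>

lemma poly_coprime_parts:
  fixes u v :: "'f::field poly"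
  assumes "v \<noteq> 0"
  obtains d u' v' where "d \<noteq> 0" "u = d * u'" "v = d * v'" "coprime u' v'"
proof -
  define I where "I = {s * u + t * v | s t. True}"
  have "\<exists>d\<in>I. \<forall>p\<in>I. d dvd p"
  proof (rule poly_ideal_principal)
    show "0 \<in> I" unfolding I_def by (auto intro!: exI[of _ 0])
    show "p + q \<in> I" if pq: "p \<in> I" "q \<in> I" for p q
    proof -
      obtain s t s' t' where "p = s * u + t * v" "q = s' * u + t' * v"
        using pq unfolding I_def by blast
      then have "p + q = (s + s') * u + (t + t') * v" by (simp add: algebra_simps)
      then show ?thesis unfolding I_def by blast
    qed
    show "r * p \<in> I" if p: "p \<in> I" for r p
    proof -
      obtain s t where "p = s * u + t * v" using p unfolding I_def by blast
      then have "r * p = (r * s) * u + (r * t) * v" by (simp add: algebra_simps)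
      then show ?thesis unfolding I_def by blast
    qed
  qed
  then obtain d where d: "d \<in> I" "\<forall>p\<in>I. d dvd p" by blast
  have "u = 1 * u + 0 * v" "v = 0 * u + 1 * v" by simp_all
  then have "u \<in> I" "v \<in> I" unfolding I_def by blast+
  then obtain u' v' where uv: "u = d * u'" "v = d * v'" using d(2) by (meson dvdE)
  have d0: "d \<noteq> 0" using uv assms by auto
  obtain s t where "d = s * u + t * v" using d(1) unfolding I_def by blast
  then have "d * (s * u' + t * v') = d * 1" using uv by (simp add: algebra_simps)
  then have "s * u' + t * v' = 1" using d0 by (simp only: mult_cancel_left) simp
  then have "coprime u' v'" by (intro coprimeI) (metis dvd_add dvd_mult)
  then show thesis using that d0 uv by blast
qed

lemma exists_prime_poly_dvd:
  fixes v :: "'f::field poly"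
  assumes "v \<noteq> 0" "\<not> is_unit v"
  shows "\<exists>p. prime_poly p \<and> p dvd v"
proof -
  have "v \<noteq> 0 \<and> \<not> is_unit v \<and> v dvd v" using assms by simp
  then obtain p where p: "p \<noteq> 0" "\<not> is_unit p" "p dvd v"
    and least: "\<And>q. q \<noteq> 0 \<and> \<not> is_unit q \<and> q dvd v \<Longrightarrow> degree p \<le> degree q"
    using ex_has_least_nat[of "\<lambda>p. p \<noteq> 0 \<and> \<not> is_unit p \<and> p dvd v" v degree] by blast
  have "irreducible p"
  proof (rule irreducibleI)
    fix b c assume bc: "p = b * c"
    show "is_unit b \<or> is_unit c"
    proof (rule ccontr)
      assume n: "\<not> (is_unit b \<or> is_unit c)"
      have nz: "b \<noteq> 0" "c \<noteq> 0" using p(1) bc by auto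
      have "b dvd v" using bc p(3) by (metis dvd_mult_left)
      then have "degree p \<le> degree b" using least n nz by blast
      then have "degree c = 0" using nz by (simp add: bc degree_mult_eq)
      then show False using n nz by (simp add: is_unit_iff_degree)
    qed
  qed (use p in auto)
  moreover define k where "k = inverse (lead_coeff p)"
  have k: "k \<noteq> 0" using p(1) by (simp add: k_def)
  then have unit: "is_unit [:k:]" by (simp add: is_unit_const_poly_iff dvd_field_iff)
  have "smult k p = [:k:] * p" by simp
  with unit have "irreducible (smult k p)" 
    using \<open>irreducible p\<close> by (metis irreducible_mult_unit_left)
  moreover have "lead_coeff (smult k p) = 1" using p(1) by (simp add: k_def)
  moreover have "smult k p dvd v" using p(3) k by (simp add: smult_dvd_iff)
  ultimately show ?thesis unfolding prime_poly_def by blast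
qed

section \<open>Modules over \<open>F[t]\<close> and linear operators\<close>

text \<open>
  An \<open>F[t]\<close>-module is the same thing as a vector space with an operator. The lemmas
  \<open>module_poly_op\<close> and \<open>module_eq_poly_op\<close> are the two directions of this dictionary; they reduce
  the statement about an operator to the statement about a module.
\<close>

lemma poly_op_eq_sum:
  assumes "vector_space scale" "degree p \<le> n"
  shows "poly_op scale a p w = (\<Sum>i\<le>n. scale (coeff p i) ((a ^^ i) w))"
proof -
  interpret vector_space scale by fact
  show ?thesis unfolding poly_op_def
    using assms(2) by (intro sum.mono_neutral_left) (auto simp: coeff_eq_0)
qed

context
  fixes scale :: "'f::field \<Rightarrow> 'w \<Rightarrow> 'w::ab_group_add" and a :: "'w \<Rightarrow> 'w"
  assumes a: "Vector_Spaces.linear scale scale a"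
begin

interpretation Vector_Spaces.linear scale scale a by (rule a)

lemma poly_op_pCons:
  "poly_op scale a (pCons c p) w = scale c w + a (poly_op scale a p w)"
proof -
  have "degree (pCons c p) \<le> Suc (degree p)" by (simp add: degree_pCons_le)
  then have "poly_op scale a (pCons c p) w
      = (\<Sum>i\<le>Suc (degree p). scale (coeff (pCons c p) i) ((a ^^ i) w))"
    by (rule poly_op_eq_sum[OF vs1.vector_space_axioms])
  also have "\<dots> = scale c w + (\<Sum>i\<le>degree p. scale (coeff p i) (a ((a ^^ i) w)))"
    by (subst sum.atMost_Suc_shift) simp
  also have "\<dots> = scale c w + a (poly_op scale a p w)"
    by (simp add: poly_op_def sum scale)
  finally show ?thesis .
qed

lemma poly_op_0: "poly_op scale a 0 w = 0"
  by (simp add: poly_op_def)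

lemma poly_op_const: "poly_op scale a [:c:] w = scale c w"
  by (simp add: poly_op_pCons poly_op_0 zero)

lemma poly_op_linear_poly: "poly_op scale a [:0, 1:] = a"
  by (rule ext) (simp add: poly_op_pCons poly_op_0 zero)

lemma poly_op_add: "poly_op scale a (p + q) w = poly_op scale a p w + poly_op scale a q w"
  by (induction p arbitrary: q rule: pCons_induct)
    (simp_all add: poly_op_0, case_tac q, simp add: poly_op_pCons add vs1.scale_left_distrib algebra_simps)

lemma poly_op_smult: "poly_op scale a (smult c p) w = scale c (poly_op scale a p w)"
  by (induction p rule: pCons_induct)
    (simp_all add: poly_op_0 poly_op_pCons vs1.scale_right_distrib scale)

lemma poly_op_mult: "poly_op scale a (p * q) w = poly_op scale a p (poly_op scale a q w)"
  by (induction p rule: pCons_induct)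
    (simp_all add: poly_op_0 poly_op_pCons poly_op_add poly_op_smult)

lemma poly_op_add_right:
  "poly_op scale a p (v + w) = poly_op scale a p v + poly_op scale a p w"
  by (induction p rule: pCons_induct)
    (simp_all add: poly_op_0 poly_op_pCons vs1.scale_right_distrib add algebra_simps)

lemma module_poly_op: "Modules.module (poly_op scale a)"
  by unfold_locales
    (simp_all add: poly_op_add poly_op_add_right poly_op_mult poly_op_const one_pCons)

end

lemma module_eq_poly_op:
  assumes "Modules.module act"
  shows "vector_space (base_scale act)"
    and "Vector_Spaces.linear (base_scale act) (base_scale act) (act p)"
    and "poly_op (base_scale act) (act [:0, 1:]) = act"
proof -
  interpret Modules.module act by fact
  show vs: "vector_space (base_scale act)"
    by unfold_locales (simp_all add: base_scale_def scale_right_distrib scale_left_distrib[symmetric] one_pCons[symmetric] mult.commute)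
  show lin: "Vector_Spaces.linear (base_scale act) (base_scale act) (act p)" for p
    using vs by (auto simp: Vector_Spaces.linear_iff base_scale_def scale_right_distrib mult.commute)
  have "poly_op (base_scale act) (act [:0, 1:]) p w = act p w" for p w
  proof (induction p rule: pCons_induct)
    case (pCons c p)
    have "pCons c p = [:c:] + [:0, 1:] * p" by simp
    then have "act (pCons c p) w = act [:c:] w + act [:0, 1:] (act p w)"
      by (metis scale_left_distrib scale_scale)
    also have "\<dots> = poly_op (base_scale act) (act [:0, 1:]) (pCons c p) w"
      by (simp only: poly_op_pCons[OF lin] pCons.IH base_scale_def)
    finally show ?case by (rule sym)
  qed (simp add: poly_op_0[OF lin])
  then show "poly_op (base_scale act) (act [:0, 1:]) = act" by (intro ext)
qed

section \<open>Divisible modules over a principal ideal domain are injective\<close>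

text \<open>
  The graph of a homomorphism from some submodule of \<open>W\<close> into \<open>W\<close>. Such partial homomorphisms are
  ordered by inclusion of their graphs, which is what Zorn's lemma needs. Single-valuedness is only
  demanded at \<open>0\<close>; closure under subtraction gives the rest.
\<close>

definition (in Modules.module) linear_graph :: "'b set \<Rightarrow> ('b \<times> 'b) set \<Rightarrow> bool" where
  "linear_graph W G \<longleftrightarrow> G \<subseteq> W \<times> W \<and> (0, 0) \<in> G
    \<and> (\<forall>x y x' y'. (x, y) \<in> G \<longrightarrow> (x', y') \<in> G \<longrightarrow> (x + x', y + y') \<in> G)
    \<and> (\<forall>r x y. (x, y) \<in> G \<longrightarrow> (scale r x, scale r y) \<in> G)
    \<and> (\<forall>y. (0, y) \<in> G \<longrightarrow> y = 0)"

text \<open>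
  This is Baer's argument. Take a maximal extension \<open>G\<close> of \<open>G0\<close>. If \<open>x\<close> is any element of \<open>W\<close>, the
  scalars \<open>r\<close> for which \<open>r x\<close> lies in the domain of \<open>G\<close> form a principal ideal \<open>(d)\<close>. Divisibility
  provides \<open>y\<close> such that \<open>d y\<close> is the value of \<open>G\<close> at \<open>d x\<close>, and then \<open>x \<mapsto> y\<close> extends \<open>G\<close>
  consistently; by maximality \<open>x\<close> was in the domain already.
\<close>

lemma (in Modules.module) divisible_imp_injective:
  assumes pid: "\<And>I :: 'a set. \<lbrakk>0 \<in> I; \<And>r s. r \<in> I \<Longrightarrow> s \<in> I \<Longrightarrow> r + s \<in> I; \<And>q r. r \<in> I \<Longrightarrow> q * r \<in> I\<rbrakk>
      \<Longrightarrow> \<exists>d\<in>I. \<forall>r\<in>I. d dvd r"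
    and W: "subspace W"
    and div: "\<And>r y. r \<noteq> 0 \<Longrightarrow> y \<in> W \<Longrightarrow> \<exists>x\<in>W. scale r x = y"
    and G0: "linear_graph W G0"
  shows "\<exists>f. f \<in> W \<rightarrow> W \<and> (\<forall>x\<in>W. \<forall>y\<in>W. f (x + y) = f x + f y)
    \<and> (\<forall>r. \<forall>x\<in>W. f (scale r x) = scale r (f x)) \<and> (\<forall>(x, y)\<in>G0. f x = y)"
proof -
  have union: "linear_graph W (\<Union>C)" "G0 \<subseteq> \<Union>C"
    if C: "C \<noteq> {}" "subset.chain {G. linear_graph W G \<and> G0 \<subseteq> G} C" for C
  proof -
    have lg: "linear_graph W G" "G0 \<subseteq> G" if "G \<in> C" for G
      using C that by (auto simp: subset.chain_def)
    show "G0 \<subseteq> \<Union>C" using lg C(1) by blast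
    have "(x + x', y + y') \<in> \<Union>C" if xy: "(x, y) \<in> \<Union>C" "(x', y') \<in> \<Union>C" for x y x' y'
    proof -
      obtain G G' where G: "G \<in> C" "(x, y) \<in> G" and G': "G' \<in> C" "(x', y') \<in> G'"
        using xy by blast
      have "G \<subseteq> G' \<or> G' \<subseteq> G" using C(2) G(1) G'(1) by (auto simp: subset_chain_def)
      then obtain H where "H \<in> C" "(x, y) \<in> H" "(x', y') \<in> H" using G G' by blast
      then show ?thesis using lg(1)[of H] unfolding linear_graph_def by blast
    qed
    moreover have "\<Union>C \<subseteq> W \<times> W" using lg(1) unfolding linear_graph_def by blast
    moreover have "(0, 0) \<in> \<Union>C" using lg(1) C(1) unfolding linear_graph_def by blast
    moreover have "(scale r x, scale r y) \<in> \<Union>C" if "(x, y) \<in> \<Union>C" for r x y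
      using lg(1) that unfolding linear_graph_def by (meson UnionE UnionI)
    moreover have "y = 0" if "(0, y) \<in> \<Union>C" for y
      using lg(1) that unfolding linear_graph_def by (meson UnionE)
    ultimately show "linear_graph W (\<Union>C)" unfolding linear_graph_def by simp
  qed
  have "{G. linear_graph W G \<and> G0 \<subseteq> G} \<noteq> {}" using G0 by auto
  then obtain G where G: "linear_graph W G" "G0 \<subseteq> G"
    and maximal: "\<And>H. linear_graph W H \<Longrightarrow> G \<subseteq> H \<Longrightarrow> H = G"
    using subset_Zorn_nonempty[of "{G. linear_graph W G \<and> G0 \<subseteq> G}"] union
    by (smt (verit) mem_Collect_eq subset_trans)
  have GW: "x \<in> W" "y \<in> W" if "(x, y) \<in> G" for x y using G(1) that by (auto simp: linear_graph_def)
  have G_0: "(0, 0) \<in> G" using G(1) by (simp add: linear_graph_def)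
  have G_add: "(x + x', y + y') \<in> G" if "(x, y) \<in> G" "(x', y') \<in> G" for x y x' y'
    using G(1) that unfolding linear_graph_def by blast
  have G_scale: "(scale r x, scale r y) \<in> G" if "(x, y) \<in> G" for r x y
    using G(1) that unfolding linear_graph_def by blast
  have G_zero: "y = 0" if "(0, y) \<in> G" for y using G(1) that unfolding linear_graph_def by blast
  have G_diff: "(x - x', y - y') \<in> G" if "(x, y) \<in> G" "(x', y') \<in> G" for x y x' y'
    using G_add[OF that(1) G_scale[OF that(2), of "-1"]] by simp
  have G_unique: "y = y'" if "(x, y) \<in> G" "(x, y') \<in> G" for x y y'
    using G_zero[of "y - y'"] G_diff[OF that] by simp
  have total: "\<exists>y. (x, y) \<in> G" if x: "x \<in> W" for x
  proof -
    define I where "I = {r. \<exists>y. (scale r x, y) \<in> G}"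
    have "\<exists>d\<in>I. \<forall>r\<in>I. d dvd r"
    proof (rule pid)
      show "0 \<in> I" using G_0 by (auto simp: I_def)
      show "r + s \<in> I" if "r \<in> I" "s \<in> I" for r s
        using that G_add by (fastforce simp: I_def scale_left_distrib)
      show "q * r \<in> I" if "r \<in> I" for q r
        using that G_scale by (fastforce simp: I_def scale_scale[symmetric] simp del: scale_scale)
    qed
    then obtain d z where d: "(scale d x, z) \<in> G" and dvd: "\<And>r. r \<in> I \<Longrightarrow> d dvd r"
      unfolding I_def by blast
    \<comment> \<open>If \<open>d = 0\<close>, the given values impose no condition on \<open>y\<close>.\<close>
    obtain y where y: "y \<in> W" "scale d y = z"
    proof (cases "d = 0")
      case True
      then show ?thesis using that[of 0] d G_zero subspace_0[OF W] by auto
    next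
      case False
      then show ?thesis using that div GW(2)[OF d] by blast
    qed
    define H where "H = {(m + scale r x, n + scale r y) | m n r. (m, n) \<in> G}"
    have "linear_graph W H" unfolding linear_graph_def
    proof (intro conjI allI impI)
      show "H \<subseteq> W \<times> W" using GW x y(1) W by (auto simp: H_def subspace_add subspace_scale)
      have "(0 + scale 0 x, 0 + scale 0 y) \<in> H" using G_0 unfolding H_def by blast
      then show "(0, 0) \<in> H" by simp
    next
      fix b c b' c' assume "(b, c) \<in> H" "(b', c') \<in> H"
      then obtain m n r m' n' r' where "b = m + scale r x" "c = n + scale r y" "(m, n) \<in> G"
        "b' = m' + scale r' x" "c' = n' + scale r' y" "(m', n') \<in> G" unfolding H_def by blast
      moreover from this have "((m + m') + scale (r + r') x, (n + n') + scale (r + r') y) \<in> H"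
        unfolding H_def using G_add by blast
      ultimately show "(b + b', c + c') \<in> H" by (simp add: scale_left_distrib algebra_simps)
    next
      fix s b c assume "(b, c) \<in> H"
      then obtain m n r where "b = m + scale r x" "c = n + scale r y" "(m, n) \<in> G"
        unfolding H_def by blast
      moreover from this have "(scale s m + scale (s * r) x, scale s n + scale (s * r) y) \<in> H"
        unfolding H_def using G_scale by blast
      ultimately show "(scale s b, scale s c) \<in> H" by (simp add: scale_right_distrib)
    next
      fix c assume "(0, c) \<in> H"
      then obtain m n r where mnr: "0 = m + scale r x" "c = n + scale r y" "(m, n) \<in> G"
        unfolding H_def by blast
      then have "(scale r x, - n) \<in> G"
        using G_scale[OF mnr(3), of "-1"] by (simp add: eq_neg_iff_add_eq_0 add.commute) (metis add.inverse_inverse eq_neg_iff_add_eq_0 )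
      moreover from this have "d dvd r" using dvd unfolding I_def by blast
      then obtain k where k: "r = k * d" by (metis dvdE mult.commute)
      moreover have "(scale r x, scale r y) \<in> G" using G_scale[OF d, of k] k y(2) by auto
      ultimately have "- n = scale r y" using G_unique by blast
      then show "c = 0" using mnr(2) by (metis add.right_inverse)
    qed
    moreover have "G \<subseteq> H"
    proof safe
      fix m n assume "(m, n) \<in> G"
      then have "(m + scale 0 x, n + scale 0 y) \<in> H" unfolding H_def by blast
      then show "(m, n) \<in> H" by simp
    qed
    ultimately have "H = G" by (rule maximal)
    moreover have "(0 + scale 1 x, 0 + scale 1 y) \<in> H" unfolding H_def using G_0 by blast
    ultimately show ?thesis by auto
  qed
  define f where "f x = (THE y. (x, y) \<in> G)" for x
  have f_eq: "f x = y" if "(x, y) \<in> G" for x y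
    using that G_unique unfolding f_def by blast
  have f: "(x, f x) \<in> G" if "x \<in> W" for x using total[OF that] f_eq by blast
  show ?thesis
  proof (intro exI[of _ f] conjI ballI allI)
    show "f \<in> W \<rightarrow> W" using f GW(2) by blast
  next
    fix x y assume "x \<in> W" "y \<in> W"
    then show "f (x + y) = f x + f y" using f G_add f_eq by blast
  next
    fix r x assume "x \<in> W"
    then show "f (scale r x) = scale r (f x)" using f G_scale f_eq by blast
  next
    fix xy assume "xy \<in> G0"
    then show "case xy of (x, y) \<Rightarrow> f x = y" using G(2) f_eq by auto
  qed
qed


section \<open>The dual of a torsion-free module\<close>

locale torsion_free_poly_module = Modules.module act
  for act :: "'f::field poly \<Rightarrow> 'v::ab_group_add \<Rightarrow> 'v" +
  assumes torsion_free: "torsion_free act"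
    and nonzero: "\<exists>v::'v. v \<noteq> 0"
begin

abbreviation Vdual :: "('v \<Rightarrow> 'f) set" where
  "Vdual \<equiv> dual (base_scale act)"

lemma vector_space_mult: "vector_space ((*) :: 'f \<Rightarrow> 'f \<Rightarrow> 'f)"
  by unfold_locales (simp_all add: algebra_simps)

lemma Vdual_iff:
  "\<rho> \<in> Vdual \<longleftrightarrow> (\<forall>x y. \<rho> (x + y) = \<rho> x + \<rho> y) \<and> (\<forall>c x. \<rho> (act [:c:] x) = c * \<rho> x)"
  using module_eq_poly_op(1)[OF module_axioms] vector_space_mult
  by (simp add: dual_def Vector_Spaces.linear_iff base_scale_def)

text \<open>
  The operator \<open>transp b\<close> is linear on all functions on \<open>V\<close>, for every map \<open>b\<close>. Hence
  \<open>dual_act act\<close> makes the whole function type an \<open>F[t]\<close>-module, of which the dual is a submodule.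
\<close>

lemma linear_transp: "Vector_Spaces.linear dual_scale dual_scale (transp b :: ('v \<Rightarrow> 'f) \<Rightarrow> _)"
proof -
  have "vector_space (dual_scale :: 'f \<Rightarrow> ('v \<Rightarrow> 'f) \<Rightarrow> _)"
    by unfold_locales (simp_all add: dual_scale_def fun_eq_iff algebra_simps)
  then show ?thesis
    by (simp add: Vector_Spaces.linear_iff transp_def dual_scale_def fun_eq_iff)
qed

lemma module_dual_act: "Modules.module (dual_act act)"
  unfolding dual_act_def by (rule module_poly_op[OF linear_transp])

interpretation D: Modules.module "dual_act act" by (rule module_dual_act)

lemma dual_act_eq:
  assumes "\<rho> \<in> Vdual"
  shows "dual_act act p \<rho> = \<rho> \<circ> act p"
proof (rule ext)
  show "dual_act act p \<rho> v = (\<rho> \<circ> act p) v" for v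
  proof (induction p arbitrary: v rule: pCons_induct)
    case 0
    have "\<rho> (act [:0:] 0) = 0" using assms unfolding Vdual_iff by (metis mult_zero_left)
    then show ?case by (simp add: dual_act_def poly_op_0[OF linear_transp])
  next
    case (pCons c p)
    have "pCons c p = [:c:] + p * [:0, 1:]" by simp
    then have "act (pCons c p) v = act [:c:] v + act p (act [:0, 1:] v)"
      by (metis scale_left_distrib scale_scale)
    then show ?case using assms pCons.IH[of "act [:0, 1:] v"]
      by (simp add: dual_act_def poly_op_pCons[OF linear_transp] transp_def dual_scale_def Vdual_iff)
  qed
qed

lemma dual_act_const: "dual_act act [:c:] \<rho> = dual_scale c \<rho>"
  by (simp add: dual_act_def poly_op_const[OF linear_transp])

lemma dual_act_0_1: "dual_act act [:0, 1:] = transp (act [:0, 1:])"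
  by (simp add: dual_act_def poly_op_linear_poly[OF linear_transp])

lemma subspace_Vdual: "D.subspace Vdual"
proof (rule D.subspaceI)
  show "0 \<in> Vdual" by (simp add: Vdual_iff)
  show "x + y \<in> Vdual" if "x \<in> Vdual" "y \<in> Vdual" for x y
    using that by (simp add: Vdual_iff algebra_simps)
  show "dual_act act p x \<in> Vdual" if "x \<in> Vdual" for p x
  proof -
    have "act p (act [:c:] v) = act [:c:] (act p v)" for c v by (simp add: mult.commute)
    then show ?thesis unfolding dual_act_eq[OF that] using that by (simp add: Vdual_iff scale_right_distrib del: scale_scale)
  qed
qed

lemma inj_act: "p \<noteq> 0 \<Longrightarrow> inj (act p)"
  using torsion_free unfolding torsion_free_def
  by (intro injI) (metis eq_iff_diff_eq_0 scale_right_diff_distrib)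

text \<open>
  Since \<open>p\<close> acts injectively on \<open>V\<close>, it has a linear left inverse \<open>g\<close>, and \<open>\<rho> \<circ> g\<close> is a \<open>p\<close>-th part
  of \<open>\<rho>\<close>.
\<close>

lemma Vdual_divisible:
  assumes p: "p \<noteq> 0" and \<rho>: "\<rho> \<in> Vdual"
  shows "\<exists>\<sigma>\<in>Vdual. dual_act act p \<sigma> = \<rho>"
proof -
  interpret vector_space_pair "base_scale act" "base_scale act"
    using module_eq_poly_op(1)[OF module_axioms] by (simp add: vector_space_pair_def)
  obtain g where g: "Vector_Spaces.linear (base_scale act) (base_scale act) g" "g \<circ> act p = id"
    using linear_injective_left_inverse[OF module_eq_poly_op(2)[OF module_axioms] inj_act[OF p]] by blast
  then have "\<rho> \<circ> g \<in> Vdual" using \<rho> by (simp add: Vdual_iff Vector_Spaces.linear_iff base_scale_def)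
  moreover have "\<rho> \<circ> g \<circ> act p = \<rho>" using g(2) by (simp add: comp_assoc)
  ultimately show ?thesis using dual_act_eq by metis
qed

text \<open>
  The submodule generated by a nonzero vector \<open>v\<close> is a copy of \<open>F[t]\<close>, and functionals extend
  from subspaces, so it suffices to find a functional \<open>lam\<close> on \<open>F[t]\<close> that vanishes on no nonzero
  ideal. Its values on the powers of \<open>t\<close> must not satisfy a linear recurrence. The indicator
  sequence of the powers of \<open>2\<close> has this property because its gaps are unbounded: multiply \<open>p\<close> by a
  power of \<open>t\<close> that puts the leading term at a power of \<open>2\<close> and all other terms in the gap below.
\<close>

lemma exists_non_torsion: "\<exists>w\<in>Vdual. \<forall>p. dual_act act p w = 0 \<longrightarrow> p = 0"
proof -
  obtain v :: 'v where v: "v \<noteq> 0" using nonzero by blast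
  define c :: "nat \<Rightarrow> 'f" where "c i = (if \<exists>k. i = 2 ^ k then 1 else 0)" for i
  define lam where "lam p = (\<Sum>i\<le>degree p. coeff p i * c i)" for p
  have lam_eq: "lam p = (\<Sum>i\<le>n. coeff p i * c i)" if "degree p \<le> n" for p n
    unfolding lam_def using that by (intro sum.mono_neutral_left) (auto simp: coeff_eq_0)
  have vs: "vector_space (smult :: 'f \<Rightarrow> _)"
    by unfold_locales (simp_all add: smult_add_right smult_add_left)
  interpret vector_space_pair smult "base_scale act"
    using module_eq_poly_op(1)[OF module_axioms] vs by (simp add: vector_space_pair_def)
  have "Vector_Spaces.linear smult (base_scale act) (\<lambda>p. act p v)"
    using module_eq_poly_op(1)[OF module_axioms] vs
    by (simp add: Vector_Spaces.linear_iff base_scale_def scale_left_distrib)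
  moreover have "inj (\<lambda>p. act p v)"
    using torsion_free v unfolding torsion_free_def
    by (intro injI) (metis eq_iff_diff_eq_0 scale_left_diff_distrib)
  ultimately obtain g where g: "Vector_Spaces.linear (base_scale act) smult g"
      "g \<circ> (\<lambda>p. act p v) = id"
    using linear_injective_left_inverse by blast
  define w where "w = lam \<circ> g"
  have lam_add: "lam (p + q) = lam p + lam q" for p q
    using lam_eq[of _ "max (degree p) (degree q)"] degree_add_le_max[of p q]
    by (simp add: algebra_simps sum.distrib)
  have lam_smult: "lam (smult a p) = a * lam p" for a p
    using lam_eq[of "smult a p" "degree p"] degree_smult_le[of a p]
    by (simp add: lam_def sum_distrib_left algebra_simps)
  have w: "w \<in> Vdual"
    using g(1) by (simp add: Vdual_iff w_def Vector_Spaces.linear_iff base_scale_def lam_add lam_smult)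
  have "p = 0" if p: "dual_act act p w = 0" for p
  proof (rule ccontr)
    assume p0: "p \<noteq> 0"
    define n where "n = degree p"
    \<comment> \<open>The terms of \<open>p * t^m\<close> have exponents above \<open>2^n\<close> and up to \<open>2^(n+1)\<close>.\<close>
    define m where "m = 2 ^ Suc n - n"
    have less: "n < 2 ^ n" by (rule less_exp)
    then have "n \<le> 2 ^ Suc n" unfolding power_Suc by linarith
    then have m: "m + n = 2 ^ Suc n" unfolding m_def by (rule le_add_diff_inverse2)
    have "lam (p * monom 1 m) = 0"
    proof -
      have "w (act p (act (monom 1 m) v)) = 0"
        using p unfolding dual_act_eq[OF w] by (metis comp_apply zero_fun_apply)
      moreover have "g (act (p * monom 1 m) v) = p * monom 1 m" using g(2) by (metis comp_apply id_apply)
      ultimately show ?thesis by (simp add: w_def)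
    qed
    moreover have "lam (p * monom 1 m) = lead_coeff p"
    proof -
      have deg: "degree (p * monom 1 m) = m + n"
        using p0 by (simp add: degree_mult_eq degree_monom_eq monom_eq_0_iff n_def)
      have cf: "coeff (p * monom 1 m) i = (if m \<le> i then coeff p (i - m) else 0)" for i
        by (simp add: mult.commute[of p] coeff_monom_mult)
      have "coeff (p * monom 1 m) i * c i = 0" if i: "i < m + n" for i
      proof (cases "m \<le> i")
        case True
        have "c i = 0"
        proof -
          have "i \<noteq> 2 ^ k" for k
          proof
            assume k: "i = 2 ^ k"
            then have "2 ^ k < (2::nat) ^ Suc n" using i m by simp
            then have "k \<le> n" by (metis less_Suc_eq_le power_less_imp_less_exp one_less_numeral_iff semiring_norm(76))
            then have "2 ^ k \<le> (2::nat) ^ n" by (simp add: power_increasing)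
            moreover have "m + n = 2 * 2 ^ n" using m by (simp only: power_Suc)
            ultimately show False using True k less by linarith
          qed
          then show ?thesis by (simp add: c_def)
        qed
        then show ?thesis by simp
      qed (simp add: cf)
      then have "lam (p * monom 1 m) = coeff (p * monom 1 m) (m + n) * c (m + n)"
        unfolding lam_def deg by (simp add: lessThan_Suc_atMost[symmetric] sum.neutral)
      moreover have "c (m + n) = 1" unfolding m c_def by metis
      ultimately show ?thesis by (simp add: cf n_def)
    qed
    ultimately show False using p0 by simp
  qed
  then show ?thesis using w by blast
qed

lemma exists_functional:
  assumes "y \<noteq> 0"
  shows "\<exists>x\<in>Vdual. x y \<noteq> 0"
proof -
  interpret vector_space_pair "(*) :: 'f \<Rightarrow> _" "base_scale act"
    using module_eq_poly_op(1)[OF module_axioms] vector_space_mult by (simp add: vector_space_pair_def)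
  have "Vector_Spaces.linear (*) (base_scale act) (\<lambda>c. base_scale act c y)"
    using vs2.vector_space_axioms vector_space_mult by (simp add: Vector_Spaces.linear_iff vs2.scale_left_distrib)
  moreover have "inj (\<lambda>c. base_scale act c y)" using assms by (simp add: inj_on_def)
  ultimately obtain g where g: "Vector_Spaces.linear (base_scale act) (*) g"
      "g \<circ> (\<lambda>c. base_scale act c y) = id"
    using linear_injective_left_inverse by blast
  have "g (base_scale act 1 y) = 1" using g(2) by (metis comp_apply id_apply)
  then have "g y = 1" by simp
  moreover have "g \<in> Vdual" using g(1) by (simp add: dual_def)
  ultimately show ?thesis by (metis zero_neq_one)
qed

text \<open>
  The kernel of \<open>p\<close> on the dual is the annihilator of \<open>p V\<close>, which is nonzero when \<open>p V\<close> is a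
  proper subspace. If \<open>g\<close> is a linear left inverse of the action of \<open>p\<close>, then \<open>b \<mapsto> b - p (g b)\<close>
  kills exactly \<open>p V\<close>, so composing it with a suitable functional gives an element of the
  annihilator.
\<close>

lemma exists_annihilated:
  assumes p: "p \<noteq> 0" and range: "range (act p) \<noteq> UNIV"
  shows "\<exists>x\<in>Vdual. x \<noteq> 0 \<and> dual_act act p x = 0"
proof -
  interpret vector_space_pair "base_scale act" "base_scale act"
    using module_eq_poly_op(1)[OF module_axioms] by (simp add: vector_space_pair_def)
  obtain g where g: "Vector_Spaces.linear (base_scale act) (base_scale act) g" "g \<circ> act p = id"
    using linear_injective_left_inverse[OF module_eq_poly_op(2)[OF module_axioms] inj_act[OF p]] by blast
  obtain v where v: "v \<notin> range (act p)" using range by blast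
  then have "v - act p (g v) \<noteq> 0" by (metis eq_iff_diff_eq_0 rangeI)
  then obtain y where y: "y \<in> Vdual" "y (v - act p (g v)) \<noteq> 0" using exists_functional by blast
  define x where "x b = y (b - act p (g b))" for b
  have "g (act [:c:] b) = act [:c:] (g b)" "g (b + b') = g b + g b'" for b b' c
    using g(1) by (simp_all add: Vector_Spaces.linear_iff base_scale_def)
  moreover have "act p (act [:c:] b) = act [:c:] (act p b)" for b c by (simp add: mult.commute)
  ultimately have add: "b + b' - act p (g (b + b')) = (b - act p (g b)) + (b' - act p (g b'))"
    and scl: "act [:c:] b - act p (g (act [:c:] b)) = act [:c:] (b - act p (g b))" for b b' c
    by (simp_all add: scale_right_distrib scale_right_diff_distrib del: scale_scale)
  have "x \<in> Vdual" using y(1) unfolding Vdual_iff x_def add scl by blast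
  moreover have "x \<noteq> 0" using y(2) unfolding x_def[symmetric] by auto
  moreover have "dual_act act p x = 0"
  proof -
    have "g (act p b) = b" for b using g(2) by (metis comp_apply id_apply)
    moreover have "y (0 + 0) = y 0 + y 0" using y(1) unfolding Vdual_iff by blast
    then have "y 0 = 0" by (metis add.right_neutral add_cancel_left_left)
    ultimately show ?thesis
      unfolding dual_act_eq[OF \<open>x \<in> Vdual\<close>] by (simp add: x_def fun_eq_iff)
  qed
  ultimately show ?thesis by blast
qed

section \<open>Central endomorphisms are fractions\<close>

abbreviation End :: "(('v \<Rightarrow> 'f) \<Rightarrow> 'v \<Rightarrow> 'f) set" where
  "End \<equiv> endos Vdual (dual_act act)"

lemma extend_to_End:
  assumes "D.linear_graph Vdual G0"
  shows "\<exists>f\<in>End. \<forall>(x, y)\<in>G0. f x = y"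
proof -
  have "\<exists>f. f \<in> Vdual \<rightarrow> Vdual \<and> (\<forall>x\<in>Vdual. \<forall>y\<in>Vdual. f (x + y) = f x + f y)
      \<and> (\<forall>r. \<forall>x\<in>Vdual. f (dual_act act r x) = dual_act act r (f x)) \<and> (\<forall>(x, y)\<in>G0. f x = y)"
    by (rule D.divisible_imp_injective[OF _ subspace_Vdual _ assms])
      (fact poly_ideal_principal, fact Vdual_divisible)
  then obtain f where f: "f \<in> Vdual \<rightarrow> Vdual" "\<forall>x\<in>Vdual. \<forall>y\<in>Vdual. f (x + y) = f x + f y"
    "\<forall>r. \<forall>x\<in>Vdual. f (dual_act act r x) = dual_act act r (f x)" "\<forall>(x, y)\<in>G0. f x = y"
    by blast
  have "G0 \<subseteq> Vdual \<times> Vdual" using assms by (simp add: D.linear_graph_def)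
  with f have "restrict f Vdual \<in> End \<and> (\<forall>(x, y)\<in>G0. restrict f Vdual x = y)"
    unfolding endos_def
    using D.subspace_add[OF subspace_Vdual] D.subspace_scale[OF subspace_Vdual] by auto
  then show ?thesis by blast
qed

lemma EndD:
  assumes "T \<in> End"
  shows "x \<in> Vdual \<Longrightarrow> T x \<in> Vdual"
    and "x \<in> Vdual \<Longrightarrow> y \<in> Vdual \<Longrightarrow> T (x + y) = T x + T y"
    and "x \<in> Vdual \<Longrightarrow> T (dual_act act p x) = dual_act act p (T x)"
  using assms by (auto simp: endos_def)

text \<open>
  Let \<open>w\<close> be a non-torsion element. If \<open>w\<close> and \<open>z w\<close> were linearly independent over \<open>F[t]\<close>,
  injectivity would give an endomorphism \<open>T\<close> with \<open>T w = 0\<close> and \<open>T (z w) = w\<close>, and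
  \<open>w = T (z w) = z (T w) = 0\<close>. So \<open>v (z w) = u w\<close> for some \<open>u\<close> and some \<open>v \<noteq> 0\<close>. This relation
  spreads from \<open>w\<close> to every \<open>x\<close> in the dual, because some endomorphism maps \<open>w\<close> to \<open>x\<close>.
\<close>

lemma center_is_fraction:
  assumes z: "z \<in> End" and comm: "\<And>T x. T \<in> End \<Longrightarrow> x \<in> Vdual \<Longrightarrow> z (T x) = T (z x)"
  shows "\<exists>u v. v \<noteq> 0 \<and> (\<forall>x\<in>Vdual. dual_act act v (z x) = dual_act act u x)"
proof -
  obtain w where w: "w \<in> Vdual" and nt: "\<And>p. dual_act act p w = 0 \<Longrightarrow> p = 0"
    using exists_non_torsion by blast
  note zw = EndD(1)[OF z w]
  note mem = D.subspace_add[OF subspace_Vdual] D.subspace_scale[OF subspace_Vdual]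
  have "\<exists>u v. v \<noteq> 0 \<and> dual_act act v (z w) = dual_act act u w"
  proof (rule ccontr)
    assume "\<not> ?thesis"
    then have indep: "v = 0" if "dual_act act v (z w) = dual_act act u w" for u v
      using that by blast
    define G where "G = {(dual_act act u w + dual_act act v (z w), dual_act act v w) | u v. True}"
    have GI: "(dual_act act u w + dual_act act v (z w), dual_act act v w) \<in> G" for u v
      unfolding G_def by blast
    have "D.linear_graph Vdual G" unfolding D.linear_graph_def
    proof (intro conjI allI impI)
      show "G \<subseteq> Vdual \<times> Vdual" using w zw mem by (auto simp: G_def)
      show "(0, 0) \<in> G" using GI[of 0 0] by simp
    next
      fix x y x' y' assume "(x, y) \<in> G" "(x', y') \<in> G"
      then obtain u v u' v' where "x = dual_act act u w + dual_act act v (z w)" "y = dual_act act v w"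
        "x' = dual_act act u' w + dual_act act v' (z w)" "y' = dual_act act v' w"
        unfolding G_def by blast
      then show "(x + x', y + y') \<in> G"
        using GI[of "u + u'" "v + v'"] by (simp add: D.scale_left_distrib algebra_simps)
    next
      fix r x y assume "(x, y) \<in> G"
      then obtain u v where "x = dual_act act u w + dual_act act v (z w)" "y = dual_act act v w"
        unfolding G_def by blast
      then show "(dual_act act r x, dual_act act r y) \<in> G"
        using GI[of "r * u" "r * v"] by (simp add: D.scale_right_distrib)
    next
      fix y assume "(0, y) \<in> G"
      then obtain u v where uv: "0 = dual_act act u w + dual_act act v (z w)" "y = dual_act act v w"
        unfolding G_def by blast
      then have "dual_act act v (z w) = dual_act act (- u) w"
        by (simp add: eq_neg_iff_add_eq_0 add.commute)
      then show "y = 0" using uv(2) indep by fastforce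
    qed
    then obtain T where T: "T \<in> End" "\<forall>(x, y)\<in>G. T x = y" using extend_to_End by blast
    have "T w = 0" using T(2) GI[of 1 0] by auto
    moreover have "T (z w) = w" using T(2) GI[of 0 1] by auto
    moreover have "z 0 = 0" using EndD(3)[OF z w, of 0] by simp
    ultimately have "w = 0" using comm[OF T(1) w] by simp
    then show False using nt[of 1] by simp
  qed
  then obtain u v where v: "v \<noteq> 0" and uv: "dual_act act v (z w) = dual_act act u w" by blast
  have "dual_act act v (z x) = dual_act act u x" if x: "x \<in> Vdual" for x
  proof -
    define G where "G = {(dual_act act r w, dual_act act r x) | r. True}"
    have GI: "(dual_act act r w, dual_act act r x) \<in> G" for r unfolding G_def by blast
    have "D.linear_graph Vdual G" unfolding D.linear_graph_def
    proof (intro conjI allI impI)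
      show "G \<subseteq> Vdual \<times> Vdual" using w x mem by (auto simp: G_def)
      show "(0, 0) \<in> G" using GI[of 0] by simp
    next
      fix b c b' c' assume "(b, c) \<in> G" "(b', c') \<in> G"
      then obtain r r' where "b = dual_act act r w" "c = dual_act act r x"
        "b' = dual_act act r' w" "c' = dual_act act r' x"
        unfolding G_def by blast
      then show "(b + b', c + c') \<in> G" using GI[of "r + r'"] by (simp add: D.scale_left_distrib)
    next
      fix s b c assume "(b, c) \<in> G"
      then obtain r where "b = dual_act act r w" "c = dual_act act r x" unfolding G_def by blast
      then show "(dual_act act s b, dual_act act s c) \<in> G" using GI[of "s * r"] by simp
    next
      fix c assume "(0, c) \<in> G"
      then obtain r where "dual_act act r w = 0" "c = dual_act act r x" unfolding G_def by auto
      then show "c = 0" using nt by fastforce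
    qed
    then obtain T where T: "T \<in> End" "\<forall>(x, y)\<in>G. T x = y" using extend_to_End by blast
    have Tw: "T w = x" using T(2) GI[of 1] by auto
    have "dual_act act v (z x) = dual_act act v (T (z w))" using comm[OF T(1) w] Tw by simp
    also have "\<dots> = T (dual_act act u w)" using EndD(3)[OF T(1) zw, of v] uv by simp
    also have "\<dots> = dual_act act u x" using EndD(3)[OF T(1) w, of u] Tw by simp
    finally show ?thesis .
  qed
  then show ?thesis using v by blast
qed


section \<open>The fractions with invertible denominator\<close>

lemma surj_act_if_no_prime_divides:
  assumes "v \<noteq> 0" "\<And>p. p \<in> P_set act \<Longrightarrow> \<not> p dvd v"
  shows "surj (act v)"
  using assms
proof (induction "degree v" arbitrary: v rule: less_induct)
  case less
  show ?case
  proof (cases "is_unit v")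
    case True
    then obtain w where "1 = v * w" by blast
    then have "act v (act w x) = x" for x by (metis scale_scale scale_one)
    then show ?thesis by (metis surjI)
  next
    case False
    then obtain p where p: "prime_poly p" "p dvd v" using exists_prime_poly_dvd less.prems(1) by blast
    then obtain w where v: "v = p * w" by blast
    have "\<not> is_unit p" using p(1) by (simp add: prime_poly_def irreducible_def)
    moreover have nz: "p \<noteq> 0" "w \<noteq> 0" using v less.prems(1) by auto
    ultimately have "degree w < degree v" by (simp add: v degree_mult_eq is_unit_iff_degree)
    moreover have "\<not> q dvd w" if "q \<in> P_set act" for q using less.prems(2)[OF that] v by auto
    ultimately have "surj (act w)" using less.hyps[OF _ nz(2)] by simp
    moreover have "surj (act p)"
    proof (rule ccontr)
      assume "\<not> surj (act p)"
      then have "p \<in> P_set act" using p(1) by (simp add: P_set_def)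
      then show False using less.prems(2) p(2) by simp
    qed
    moreover have "act v = act p \<circ> act w" by (auto simp: v)
    ultimately show ?thesis by (metis comp_surj)
  qed
qed

text \<open>
  By \<open>K_Int_Rhat_eq\<close> membership in \<open>A_set act\<close> means that no prime of \<open>P_set act\<close> divides the
  reduced denominator, and the denominators without such a divisor are those that act
  surjectively.
\<close>

lemma A_set_iff:
  "r \<in> A_set act \<longleftrightarrow> (\<exists>u v. v \<noteq> 0 \<and> r = Fract u v \<and> coprime u v \<and> surj (act v))"
proof
  assume r: "r \<in> A_set act"
  obtain u0 v0 where r0: "r = Fract u0 v0" "v0 \<noteq> 0" by (cases r) auto
  obtain d u v where uv: "d \<noteq> 0" "u0 = d * u" "v0 = d * v" "coprime u v"
    using poly_coprime_parts[OF r0(2)] by blast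
  have v: "v \<noteq> 0" and r_eq: "r = Fract u v" using r0 uv by (auto simp: eq_fract)
  have "\<not> p dvd v" if p: "p \<in> P_set act" for p
  proof
    assume dvd: "p dvd v"
    have pp: "prime_poly p" and irr: "irreducible p" using p by (auto simp: P_set_def prime_poly_def)
    have "r \<in> R_loc p" using r p K_Int_Rhat_eq[OF pp] by (auto simp: A_set_def)
    then obtain u1 v1 where 1: "r = Fract u1 v1" "v1 \<noteq> 0" "coprime v1 p" by (auto simp: R_loc_def)
    then have "u * v1 = u1 * v" using r_eq v by (simp add: eq_fract)
    then have "p dvd u * v1" using dvd by simp
    moreover have "\<not> p dvd v1" using 1(3) by (simp only: irreducible_coprime_iff[OF irr] not_False_eq_True)
    then obtain s t where "s * v1 + t * p = 1" using irreducible_bezout[OF irr] by blast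
    moreover have "u * (s * v1 + t * p) = s * (u * v1) + (u * t) * p" by (simp add: algebra_simps)
    ultimately have "p dvd u * 1" by (metis dvd_add dvd_mult dvd_triv_right)
    then have "p dvd u" by simp
    then have "is_unit p" using dvd uv(4) coprime_common_divisor by blast
    then show False using irr by (simp add: irreducible_def)
  qed
  then have "surj (act v)" by (rule surj_act_if_no_prime_divides[OF v])
  then show "\<exists>u v. v \<noteq> 0 \<and> r = Fract u v \<and> coprime u v \<and> surj (act v)"
    using v r_eq uv(4) by (intro exI conjI)
next
  assume "\<exists>u v. v \<noteq> 0 \<and> r = Fract u v \<and> coprime u v \<and> surj (act v)"
  then obtain u v where v: "v \<noteq> 0" "r = Fract u v" "surj (act v)" by blast
  have "r \<in> K_Int_Rhat p" if p: "p \<in> P_set act" for p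
  proof -
    have pp: "prime_poly p" and irr: "irreducible p" using p by (auto simp: P_set_def prime_poly_def)
    have "\<not> p dvd v"
    proof
      assume "p dvd v"
      then obtain w where "v = p * w" by blast
      then have "act v = act p \<circ> act w" by auto
      then have "surj (act p)" using v(3) by (metis surj_def comp_apply)
      then show False using p by (simp add: P_set_def)
    qed
    then show ?thesis
      unfolding K_Int_Rhat_eq[OF pp] R_loc_def irreducible_coprime_iff[OF irr, symmetric]
      using v by blast
  qed
  then show "r \<in> A_set act" by (simp add: A_set_def)
qed

section \<open>The center as an algebra of fractions\<close>

lemma dual_act_inj_if_surj:
  assumes "surj (act v)" "x \<in> Vdual" "y \<in> Vdual" "dual_act act v x = dual_act act v y"
  shows "x = y"
proof (rule ext)
  fix b
  obtain b' where "b = act v b'" using assms(1) by (rule surjE)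
  then show "x b = y b" using assms(4) by (simp add: dual_act_eq assms(2,3) fun_eq_iff)
qed

abbreviation Z :: "(('v \<Rightarrow> 'f) \<Rightarrow> 'v \<Rightarrow> 'f) set" where
  "Z \<equiv> carrier (center_alg (L_dual_R act))"

lemma Z_iff: "z \<in> Z \<longleftrightarrow> z \<in> End \<and> (\<forall>T\<in>End. \<forall>x\<in>Vdual. z (T x) = T (z x))"
proof -
  have "compose Vdual z T = compose Vdual T z \<longleftrightarrow> (\<forall>x\<in>Vdual. z (T x) = T (z x))" for T
    by (auto simp: compose_def fun_eq_iff restrict_def)
  then show ?thesis by (simp add: center_alg_def commutant_def L_dual_R_def op_alg_def)
qed

text \<open>
  The relation \<open>z = r\<close> on the dual, with the denominator of \<open>r\<close> cleared: division by \<open>v\<close> is in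
  general ambiguous on the dual, which has torsion.
\<close>

definition acts_as :: "(('v \<Rightarrow> 'f) \<Rightarrow> 'v \<Rightarrow> 'f) \<Rightarrow> 'f poly fract \<Rightarrow> bool" where
  "acts_as z r \<longleftrightarrow>
    (\<exists>u v. v \<noteq> 0 \<and> r = Fract u v \<and> (\<forall>x\<in>Vdual. dual_act act v (z x) = dual_act act u x))"

text \<open>
  An element without torsion determines the fraction.
\<close>

lemma acts_as_unique:
  assumes "acts_as z r" "acts_as z r'"
  shows "r = r'"
proof -
  obtain w where w: "w \<in> Vdual" "\<And>p. dual_act act p w = 0 \<Longrightarrow> p = 0"
    using exists_non_torsion by blast
  obtain u v u' v' where uv: "v \<noteq> 0" "r = Fract u v" "dual_act act v (z w) = dual_act act u w"
    and uv': "v' \<noteq> 0" "r' = Fract u' v'" "dual_act act v' (z w) = dual_act act u' w"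
    using assms w(1) unfolding acts_as_def by blast
  have "dual_act act (u * v') w = dual_act act v' (dual_act act v (z w))"
    by (simp add: uv(3) mult.commute)
  also have "\<dots> = dual_act act v (dual_act act v' (z w))" by (simp add: mult.commute)
  also have "\<dots> = dual_act act (u' * v) w" by (simp add: uv'(3) mult.commute)
  finally have "dual_act act (u * v' - u' * v) w = 0" by (simp add: D.scale_left_diff_distrib)
  then have "u * v' = u' * v" using w(2) by fastforce
  then show ?thesis using uv uv' by (simp add: eq_fract)
qed

text \<open>
  Although a denominator may annihilate elements of the dual, it determines \<open>z\<close>: every \<open>x\<close> is
  divisible by it, and \<open>z (v y) = v (z y) = u y\<close>.
\<close>

lemma acts_as_inj:
  assumes z: "z \<in> End" "acts_as z r" and z': "z' \<in> End" "acts_as z' r"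
  shows "z = z'"
proof -
  obtain u v u' v' where uv: "v \<noteq> 0" "r = Fract u v" "\<And>x. x \<in> Vdual \<Longrightarrow> dual_act act v (z x) = dual_act act u x"
    and uv': "v' \<noteq> 0" "r = Fract u' v'" "\<And>x. x \<in> Vdual \<Longrightarrow> dual_act act v' (z' x) = dual_act act u' x"
    using z(2) z'(2) unfolding acts_as_def by blast
  have eq: "u * v' = u' * v" using uv uv' by (simp add: eq_fract)
  have "z x = z' x" if x: "x \<in> Vdual" for x
  proof -
    obtain y where y: "y \<in> Vdual" "dual_act act (v' * v) y = x"
      using Vdual_divisible[OF _ x, of "v' * v"] uv(1) uv'(1) by auto
    have "z x = dual_act act v' (dual_act act v (z y))" using EndD(3)[OF z(1) y(1)] y(2) by auto
    also have "\<dots> = dual_act act (u * v') y" using uv(3)[OF y(1)] by (simp add: mult.commute)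
    also have "\<dots> = dual_act act v (dual_act act v' (z' y))"
      using uv'(3)[OF y(1)] by (simp add: eq mult.commute)
    also have "\<dots> = z' x" using EndD(3)[OF z'(1) y(1)] y(2) by (auto simp: mult.commute)
    finally show ?thesis .
  qed
  moreover have "z \<in> extensional Vdual" "z' \<in> extensional Vdual"
    using z(1) z'(1) by (auto simp: endos_def PiE_def)
  ultimately show ?thesis by (metis extensionalityI)
qed

text \<open>
  Write the fraction in lowest terms \<open>u/v\<close>; divisibility of the dual allows the common factor to
  be cancelled. If a prime \<open>p\<close> with \<open>p V \<noteq> V\<close> divided \<open>v\<close>, a nonzero \<open>x\<close> with \<open>p x = 0\<close> would
  satisfy \<open>u x = v (z x) = z (v x) = 0\<close> as well, which contradicts the coprimality of \<open>u\<close> and \<open>p\<close>.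
\<close>

lemma acts_as_in_A_set:
  assumes z: "z \<in> End" and r: "acts_as z r"
  shows "r \<in> A_set act"
proof -
  obtain u0 v0 where r0: "v0 \<noteq> 0" "r = Fract u0 v0"
    "\<And>x. x \<in> Vdual \<Longrightarrow> dual_act act v0 (z x) = dual_act act u0 x"
    using r unfolding acts_as_def by blast
  obtain d u v where uv: "d \<noteq> 0" "u0 = d * u" "v0 = d * v" "coprime u v"
    using poly_coprime_parts[OF r0(1)] by blast
  have v: "v \<noteq> 0" and r_eq: "r = Fract u v" using r0 uv by (auto simp: eq_fract)
  have act_z: "dual_act act v (z x) = dual_act act u x" if x: "x \<in> Vdual" for x
  proof -
    obtain y where y: "y \<in> Vdual" "dual_act act d y = x" using Vdual_divisible[OF uv(1) x] by blast
    then show ?thesis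
      using r0(3)[OF y(1)] EndD(3)[OF z y(1), of d] by (auto simp: uv mult.commute)
  qed
  have "\<not> p dvd v" if p: "p \<in> P_set act" for p
  proof
    assume dvd: "p dvd v"
    then obtain w where w: "v = w * p" by (metis dvdE mult.commute)
    have irr: "irreducible p" and range: "range (act p) \<noteq> UNIV"
      using p by (auto simp: P_set_def prime_poly_def)
    then have "p \<noteq> 0" by auto
    then obtain x where x: "x \<in> Vdual" "x \<noteq> 0" "dual_act act p x = 0"
      using exists_annihilated range by blast
    have "dual_act act v x = dual_act act w (dual_act act p x)" by (simp add: w)
    then have "z (dual_act act v x) = z (dual_act act 0 x)" by (simp add: x(3))
    then have "dual_act act u x = 0"
      using act_z[OF x(1)] EndD(3)[OF z x(1), of v] EndD(3)[OF z x(1), of 0] by simp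
    moreover have "\<not> p dvd u"
      using dvd uv(4) irr by (metis coprime_common_divisor irreducible_not_unit)
    then obtain s t where "s * u + t * p = 1" using irreducible_bezout[OF irr] by blast
    then have "x = dual_act act s (dual_act act u x) + dual_act act t (dual_act act p x)"
      by (metis D.scale_left_distrib D.scale_one D.scale_scale)
    ultimately show False using x by simp
  qed
  then have "surj (act v)" by (rule surj_act_if_no_prime_divides[OF v])
  then show ?thesis unfolding A_set_iff using v r_eq uv(4) by (intro exI conjI)
qed

text \<open>
  If \<open>v\<close> acts surjectively on \<open>V\<close>, it acts bijectively on the dual, so \<open>u/v\<close> defines an operator
  there. It commutes with every endomorphism because the scalars \<open>u\<close> and \<open>v\<close> do.
\<close>

lemma exists_acts_as:
  assumes "r \<in> A_set act"
  shows "\<exists>z\<in>Z. acts_as z r"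
proof -
  obtain u v where v: "v \<noteq> 0" "r = Fract u v" "surj (act v)" using assms A_set_iff by blast
  note cancel = dual_act_inj_if_surj[OF v(3)]
  note mem = D.subspace_add[OF subspace_Vdual] D.subspace_scale[OF subspace_Vdual]
  have "\<forall>x\<in>Vdual. \<exists>y. y \<in> Vdual \<and> dual_act act v y = dual_act act u x"
    using Vdual_divisible[OF v(1)] mem(2) by blast
  then obtain z0 where "\<forall>x\<in>Vdual. z0 x \<in> Vdual \<and> dual_act act v (z0 x) = dual_act act u x"
    using bchoice[of Vdual] by metis
  moreover define z where "z = restrict z0 Vdual"
  ultimately have z: "z x \<in> Vdual" "dual_act act v (z x) = dual_act act u x" if "x \<in> Vdual" for x
    using that by auto
  have "z (x + y) = z x + z y" if "x \<in> Vdual" "y \<in> Vdual" for x y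
    by (rule cancel) (use that in \<open>auto simp: z mem D.scale_right_distrib\<close>)
  moreover have zp: "z (dual_act act p x) = dual_act act p (z x)" if x: "x \<in> Vdual" for p x
  proof (rule cancel)
    have "dual_act act v (dual_act act p (z x)) = dual_act act p (dual_act act v (z x))"
      by (simp add: mult.commute)
    also have "\<dots> = dual_act act u (dual_act act p x)" by (simp add: z x mult.commute)
    finally show "dual_act act v (z (dual_act act p x)) = dual_act act v (dual_act act p (z x))"
      using z x mem by simp
  qed (use x z mem in auto)
  ultimately have "z \<in> End" using z by (auto simp: endos_def z_def)
  moreover have "z (T x) = T (z x)" if T: "T \<in> End" and x: "x \<in> Vdual" for T x
  proof (rule cancel)
    note Tx = EndD(1)[OF T x]
    have "dual_act act v (T (z x)) = T (dual_act act u x)"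
      using EndD(3)[OF T z(1)[OF x], of v] z(2)[OF x] by simp
    also have "\<dots> = dual_act act v (z (T x))" using EndD(3)[OF T x] z(2)[OF Tx] by simp
    finally show "dual_act act v (z (T x)) = dual_act act v (T (z x))" by (rule sym)
    show "z (T x) \<in> Vdual" "T (z x) \<in> Vdual" using z(1) EndD(1)[OF T] x by blast+
  qed
  ultimately have "z \<in> Z" by (simp add: Z_iff)
  moreover have "acts_as z r" unfolding acts_as_def using v(1,2) z(2)
    by (intro exI[of _ u] exI[of _ v]) simp
  ultimately show ?thesis by blast
qed

lemma center_isomorphic: "alg_isomorphic (center_alg (L_dual_R act)) (rat_alg (A_set act))"
proof -
  define h where "h z = (THE r. acts_as z r)" for z
  have h_eq: "h z = r" if "acts_as z r" for z r
    unfolding h_def using that acts_as_unique by blast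
  have h: "acts_as z (h z)" if "z \<in> Z" for z
  proof -
    have "\<exists>u v. v \<noteq> 0 \<and> (\<forall>x\<in>Vdual. dual_act act v (z x) = dual_act act u x)"
      using that unfolding Z_iff by (intro center_is_fraction) auto
    then obtain r where "acts_as z r" unfolding acts_as_def by blast
    then show ?thesis using h_eq by simp
  qed
  have ZE: "z \<in> End" if "z \<in> Z" for z using that by (simp add: Z_iff)
  have hE: "\<exists>u v. v \<noteq> 0 \<and> h z = Fract u v \<and> (\<forall>x\<in>Vdual. dual_act act v (z x) = dual_act act u x)"
    if "z \<in> Z" for z using h[OF that] by (simp add: acts_as_def)
  have hom: "h \<in> ring_hom (center_alg (L_dual_R act)) (rat_alg (A_set act))"
  proof (rule ring_hom_memI)
    show "h z \<in> carrier (rat_alg (A_set act))" if "z \<in> Z" for z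
      using acts_as_in_A_set[OF ZE[OF that] h[OF that]] by (simp add: rat_alg_def)
    have "acts_as (\<one>\<^bsub>center_alg (L_dual_R act)\<^esub>) 1"
      unfolding acts_as_def
      by (rule exI[of _ 1], rule exI[of _ 1])
        (simp add: center_alg_def L_dual_R_def op_alg_def One_fract_def)
    then show "h \<one>\<^bsub>center_alg (L_dual_R act)\<^esub> = \<one>\<^bsub>rat_alg (A_set act)\<^esub>"
      using h_eq by (simp add: rat_alg_def)
  next
    fix y z assume y: "y \<in> Z" and z: "z \<in> Z"
    obtain u v where uv: "v \<noteq> 0" "h y = Fract u v"
      "\<And>x. x \<in> Vdual \<Longrightarrow> dual_act act v (y x) = dual_act act u x" using hE[OF y] by blast
    obtain u' v' where uv': "v' \<noteq> 0" "h z = Fract u' v'"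
      "\<And>x. x \<in> Vdual \<Longrightarrow> dual_act act v' (z x) = dual_act act u' x" using hE[OF z] by blast
    have "dual_act act (v * v') (y (z x)) = dual_act act (u * u') x" if x: "x \<in> Vdual" for x
    proof -
      have "dual_act act (v * v') (y (z x)) = dual_act act v' (dual_act act v (y (z x)))"
        by (simp add: mult.commute)
      also have "\<dots> = dual_act act u (dual_act act v' (z x))"
        using uv(3)[OF EndD(1)[OF ZE[OF z] x]] by (simp add: mult.commute)
      finally show ?thesis using uv'(3)[OF x] by simp
    qed
    then have "acts_as (y \<otimes>\<^bsub>center_alg (L_dual_R act)\<^esub> z) (h y * h z)"
      unfolding acts_as_def using uv uv'
      by (intro exI[of _ "u * u'"] exI[of _ "v * v'"])
        (simp add: center_alg_def L_dual_R_def op_alg_def compose_eq)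
    then show "h (y \<otimes>\<^bsub>center_alg (L_dual_R act)\<^esub> z) = h y \<otimes>\<^bsub>rat_alg (A_set act)\<^esub> h z"
      using h_eq by (simp add: rat_alg_def)
    have "dual_act act (v * v') (y x + z x) = dual_act act (u * v' + u' * v) x" if x: "x \<in> Vdual" for x
    proof -
      have "dual_act act (v * v') (y x + z x)
          = dual_act act v' (dual_act act v (y x)) + dual_act act v (dual_act act v' (z x))"
        by (simp add: D.scale_right_distrib mult.commute)
      then show ?thesis using uv(3)[OF x] uv'(3)[OF x] by (simp add: D.scale_left_distrib mult.commute)
    qed
    then have "acts_as (y \<oplus>\<^bsub>center_alg (L_dual_R act)\<^esub> z) (h y + h z)"
      unfolding acts_as_def using uv uv'
      by (intro exI[of _ "u * v' + u' * v"] exI[of _ "v * v'"])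
        (simp add: center_alg_def L_dual_R_def op_alg_def)
    then show "h (y \<oplus>\<^bsub>center_alg (L_dual_R act)\<^esub> z) = h y \<oplus>\<^bsub>rat_alg (A_set act)\<^esub> h z"
      using h_eq by (simp add: rat_alg_def)
  qed
  have "inj_on h Z"
  proof (rule inj_onI)
    fix y z assume "y \<in> Z" "z \<in> Z" "h y = h z"
    then show "y = z" using acts_as_inj[of y "h y" z] h[of y] h[of z] ZE by simp
  qed
  moreover have "h ` Z = A_set act"
  proof
    show "h ` Z \<subseteq> A_set act" using acts_as_in_A_set h ZE by blast
    show "A_set act \<subseteq> h ` Z" using exists_acts_as h_eq by blast
  qed
  ultimately have "bij_betw h Z (carrier (rat_alg (A_set act)))"
    by (simp add: bij_betw_def rat_alg_def)
  with hom have "h \<in> ring_iso (center_alg (L_dual_R act)) (rat_alg (A_set act))"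
    by (simp add: ring_iso_def)
  moreover have "h (c \<odot>\<^bsub>center_alg (L_dual_R act)\<^esub> z) = c \<odot>\<^bsub>rat_alg (A_set act)\<^esub> h z"
    if z: "z \<in> Z" for c z
  proof -
    obtain u v where uv: "v \<noteq> 0" "h z = Fract u v"
      "\<And>x. x \<in> Vdual \<Longrightarrow> dual_act act v (z x) = dual_act act u x" using hE[OF z] by blast
    have "dual_act act v (dual_scale c (z x)) = dual_act act ([:c:] * u) x" if x: "x \<in> Vdual" for x
    proof -
      have "dual_act act v (dual_scale c (z x)) = dual_act act [:c:] (dual_act act v (z x))"
        unfolding dual_act_const[symmetric] D.scale_scale by (simp only: mult.commute)
      then show ?thesis using uv(3)[OF x] by (simp only: D.scale_scale)
    qed
    then have "acts_as (c \<odot>\<^bsub>center_alg (L_dual_R act)\<^esub> z) (Fract [:c:] 1 * h z)"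
      unfolding acts_as_def using uv
      by (intro exI[of _ "[:c:] * u"] exI[of _ v])
        (simp add: center_alg_def L_dual_R_def op_alg_def)
    then show ?thesis using h_eq by (simp add: rat_alg_def)
  qed
  ultimately have "h \<in> alg_iso (center_alg (L_dual_R act)) (rat_alg (A_set act))"
    by (simp add: alg_iso_def)
  then show ?thesis by (auto simp: alg_isomorphic_def)
qed

section \<open>Bicommutant and center\<close>

text \<open>
  An operator commutes with \<open>a*\<close> iff it commutes with all polynomials in \<open>a*\<close>.
\<close>

lemma commutant_adj:
  "commutant (L_dual (base_scale act)) {adj (base_scale act) (act [:0, 1:])} = End"
proof -
  note mem = D.subspace_scale[OF subspace_Vdual]
  have comm: "compose Vdual z (adj (base_scale act) (act [:0, 1:]))
      = compose Vdual (adj (base_scale act) (act [:0, 1:])) z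
    \<longleftrightarrow> (\<forall>x\<in>Vdual. z (dual_act act [:0, 1:] x) = dual_act act [:0, 1:] (z x))"
    if "z \<in> Vdual \<rightarrow>\<^sub>E Vdual" for z
    using that unfolding adj_def dual_act_0_1[symmetric]
    by (auto simp: compose_def fun_eq_iff restrict_def PiE_iff)
  have lin: "(\<forall>p. \<forall>x\<in>Vdual. z (dual_act act p x) = dual_act act p (z x)) \<longleftrightarrow>
      (\<forall>c. \<forall>x\<in>Vdual. z (dual_scale c x) = dual_scale c (z x)) \<and>
      (\<forall>x\<in>Vdual. z (dual_act act [:0, 1:] x) = dual_act act [:0, 1:] (z x))" (is "?L \<longleftrightarrow> ?R")
    if add: "\<forall>x\<in>Vdual. \<forall>y\<in>Vdual. z (x + y) = z x + z y" for z
  proof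
    show "?L \<Longrightarrow> ?R" by (metis dual_act_const)
    assume R: ?R
    have "\<forall>x\<in>Vdual. z (dual_act act p x) = dual_act act p (z x)" for p
    proof (induction p rule: pCons_induct)
      case 0
      have "z (dual_act act [:0:] 0) = dual_act act [:0:] (z 0)"
        using R D.subspace_0[OF subspace_Vdual] unfolding dual_act_const by blast
      then have "z 0 = 0" by simp
      then show ?case by (simp only: D.scale_zero_left simp_thms) simp
    next
      case (pCons c p)
      have split: "dual_act act (pCons c p) x = dual_scale c x + dual_act act [:0, 1:] (dual_act act p x)" for x
      proof -
        have "pCons c p = [:c:] + [:0, 1:] * p" by simp
        then show ?thesis by (metis D.scale_left_distrib D.scale_scale dual_act_const)
      qed
      have scale: "dual_scale c x \<in> Vdual" if "x \<in> Vdual" for x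
        using mem[OF that, of "[:c:]"] by (simp add: dual_act_const)
      show ?case
      proof
        fix x assume x: "x \<in> Vdual"
        have "z (dual_act act (pCons c p) x)
            = z (dual_scale c x) + z (dual_act act [:0, 1:] (dual_act act p x))"
          unfolding split using add scale[OF x] mem[OF mem[OF x]] by blast
        also have "z (dual_scale c x) = dual_scale c (z x)" using R x by blast
        also have "z (dual_act act [:0, 1:] (dual_act act p x)) = dual_act act [:0, 1:] (z (dual_act act p x))"
          using R mem[OF x] by blast
        also have "z (dual_act act p x) = dual_act act p (z x)" using pCons.IH x by blast
        finally show "z (dual_act act (pCons c p) x) = dual_act act (pCons c p) (z x)"
          unfolding split .
      qed
    qed
    then show ?L by blast
  qed
  show ?thesis
  proof (rule Set.set_eqI)
    fix z
    show "z \<in> commutant (L_dual (base_scale act)) {adj (base_scale act) (act [:0, 1:])} \<longleftrightarrow> z \<in> End"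
    proof (cases "z \<in> Vdual \<rightarrow>\<^sub>E Vdual \<and> (\<forall>x\<in>Vdual. \<forall>y\<in>Vdual. z (x + y) = z x + z y)")
      case True
      then show ?thesis
        using comm[of z] lin[of z]
        by (simp only: commutant_def L_dual_def op_alg_def endos_def partial_object.simps
            monoid.simps mem_Collect_eq ball_simps singleton_iff ball_triv simp_thms) blast
    next
      case False
      then show ?thesis by (auto simp: commutant_def L_dual_def op_alg_def endos_def)
    qed
  qed
qed

text \<open>
  Since \<open>a*\<close> belongs to its own commutant, the bicommutant lies in the commutant and is
  therefore its center.
\<close>

lemma bicommutant_eq_center:
  "bicommutant_alg (L_dual (base_scale act)) {adj (base_scale act) (act [:0, 1:])}
    = center_alg (L_dual_R act)"
proof -
  let ?a = "adj (base_scale act) (act [:0, 1:])"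
  have "?a \<in> End"
    unfolding adj_def dual_act_0_1[symmetric] endos_def
    using D.subspace_add[OF subspace_Vdual] D.subspace_scale[OF subspace_Vdual]
    by (auto simp: D.scale_right_distrib mult.commute)
  then have "commutant (L_dual (base_scale act)) End \<subseteq> End"
    using commutant_adj unfolding commutant_def by blast
  moreover have "End \<subseteq> carrier (L_dual (base_scale act))"
    unfolding commutant_adj[symmetric] by (auto simp: commutant_def)
  ultimately have "commutant (L_dual (base_scale act)) End = commutant (L_dual_R act) End"
    unfolding commutant_def by (auto simp: L_dual_def L_dual_R_def op_alg_def)
  then show ?thesis
    unfolding bicommutant_alg_def center_alg_def commutant_adj
    by (simp add: L_dual_def L_dual_R_def op_alg_def)
qed

end

section \<open>Center and bicommutant as subalgebras of \<open>F(t)\<close>\<close>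

theorem proposition3p3:
  fixes act :: "'f::field poly \<Rightarrow> 'v::ab_group_add \<Rightarrow> 'v"
    and scale :: "'f \<Rightarrow> 'v \<Rightarrow> 'v" and a :: "'v \<Rightarrow> 'v"
  shows
    "(Modules.module act \<and> (\<exists>v::'v. v \<noteq> 0) \<and> torsion_free act
        \<longrightarrow> alg_isomorphic (center_alg (L_dual_R act)) (rat_alg (A_set act)))
     \<and>
     (vector_space scale \<and> (\<exists>v::'v. v \<noteq> 0) \<and> Vector_Spaces.linear scale scale a
        \<and> (\<forall>p. p \<noteq> 0 \<longrightarrow> inj (poly_op scale a p))
        \<longrightarrow> A_set (poly_op scale a) = A_inv_set scale a
          \<and> alg_isomorphic (bicommutant_alg (L_dual scale) {adj scale a})
              (rat_alg (A_inv_set scale a)))"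
proof (intro conjI impI)
  assume "Modules.module act \<and> (\<exists>v::'v. v \<noteq> 0) \<and> torsion_free act"
  then interpret torsion_free_poly_module act
    by (simp add: torsion_free_poly_module_def torsion_free_poly_module_axioms_def)
  show "alg_isomorphic (center_alg (L_dual_R act)) (rat_alg (A_set act))" by (rule center_isomorphic)
next
  assume asm: "vector_space scale \<and> (\<exists>v::'v. v \<noteq> 0) \<and> Vector_Spaces.linear scale scale a
    \<and> (\<forall>p. p \<noteq> 0 \<longrightarrow> inj (poly_op scale a p))"
  then have lin: "Vector_Spaces.linear scale scale a" by blast
  interpret vector_space_pair scale scale using asm by (simp add: vector_space_pair_def)
  have module: "Modules.module (poly_op scale a)" by (rule module_poly_op[OF lin])
  then interpret P: Modules.module "poly_op scale a" .
  have "torsion_free (poly_op scale a)"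
    unfolding torsion_free_def
  proof (intro allI impI)
    fix r v assume "poly_op scale a r v = 0"
    then have "poly_op scale a r v = poly_op scale a r 0" by simp
    then show "r = 0 \<or> v = 0" using asm by (meson injD)
  qed
  then interpret torsion_free_poly_module "poly_op scale a"
    using module asm by (simp add: torsion_free_poly_module_def torsion_free_poly_module_axioms_def)
  have scale: "base_scale (poly_op scale a) = scale"
    by (simp add: base_scale_def fun_eq_iff poly_op_const[OF lin])
  have t: "poly_op scale a [:0, 1:] = a" by (rule poly_op_linear_poly[OF lin])
  have "invertible_op scale (poly_op scale a v) \<longleftrightarrow> surj (poly_op scale a v)" if nz: "v \<noteq> 0" for v
  proof
    assume "invertible_op scale (poly_op scale a v)"
    then show "surj (poly_op scale a v)" unfolding invertible_op_def by (metis comp_apply id_apply surj_def)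
  next
    assume surj: "surj (poly_op scale a v)"
    obtain S where S: "Vector_Spaces.linear scale scale S" "S \<circ> poly_op scale a v = id"
      using linear_injective_left_inverse[OF module_eq_poly_op(2)[OF module, unfolded scale] inj_act[OF nz]]
      by blast
    then have "poly_op scale a v \<circ> S = id" using surj by (auto simp: fun_eq_iff surj_def) metis
    then show "invertible_op scale (poly_op scale a v)" using S unfolding invertible_op_def by blast
  qed
  then have "r \<in> A_set (poly_op scale a) \<longleftrightarrow> r \<in> A_inv_set scale a" for r
    unfolding A_set_iff A_inv_set_def mem_Collect_eq by metis
  then show A: "A_set (poly_op scale a) = A_inv_set scale a"
    by blast
  show "alg_isomorphic (bicommutant_alg (L_dual scale) {adj scale a}) (rat_alg (A_inv_set scale a))"
    using center_isomorphic unfolding A bicommutant_eq_center[symmetric] scale t .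
qed

end
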